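(* Let $g\in A_n$. Suppose that, for some $k\ge 1$, the presentation of $g$ as a product of mutually coprime cycles contains an odd number of $2k$-cycles. Then $g$ cannot be written in the form $g=h^2t^2$ with $h,t\in A_n$ mutually coprime. In particular (the case $t=e$), $g$ is not of the form $h^2$ with $h\in A_n$. Furthermore, the same holds even if $h,t$ are allowed to be in $S_n$.
   Context: Cycles (respectively permutations) are called mutually coprime if they have no common elements, i.e. the sets of points they move are pairwise disjoint. $e$ denotes the identity permutation. *)

theory Defs
  imports "HOL-Algebra.Sym_Groups"
begin

definition moved_points :: "('a \<Rightarrow> 'a) \<Rightarrow> 'a set"
  where "moved_points p = {x. p x \<noteq> x}"

definition mutually_coprime :: "('a \<Rightarrow> 'a) \<Rightarrow> ('a \<Rightarrow> 'a) \<Rightarrow> bool"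
  where "mutually_coprime p q \<longleftrightarrow> moved_points p \<inter> moved_points q = {}"

text \<open>
  A list of cycles, each cycle being given by the list of its points. Fixed points are not
  recorded as cycles of length 1. Since \<^const>\<open>mutually_coprime\<close> is symmetric,
  \<^const>\<open>sorted_wrt\<close> says that the cycles at any two different positions are coprime.
  The identity has the empty presentation.
\<close>

definition cycle_presentation :: "'a list list \<Rightarrow> ('a \<Rightarrow> 'a) \<Rightarrow> bool"
  where "cycle_presentation cs g \<longleftrightarrow>
    (\<forall>c \<in> set cs. cycle c \<and> 2 \<le> length c) \<and>
    sorted_wrt (\<lambda>c d. mutually_coprime (cycle_of_list c) (cycle_of_list d)) cs \<and>
    g = foldr (\<lambda>c p. cycle_of_list c \<circ> p) cs id"

definition num_cycles :: "nat \<Rightarrow> 'a list list \<Rightarrow> nat"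
  where "num_cycles m cs = length (filter (\<lambda>c. length c = m) cs)"

lemma moved_points_cycle_subset: "moved_points (cycle_of_list c) \<subseteq> set c"
  using id_outside_supp[of _ c] by (auto simp: moved_points_def)

lemma cycle_of_list_short: "\<not> 2 \<le> length c \<Longrightarrow> cycle_of_list c = id"
  by (cases c rule: cycle_of_list.cases) auto

text \<open>Presentations exist, so a hypothesis on a presentation of a permutation is not vacuous.\<close>

lemma cycle_presentation_exists_aux:
  assumes "cycle_decomp I p"
  shows "\<exists>cs. cycle_presentation cs p \<and> (\<forall>c \<in> set cs. set c \<subseteq> I)"
  using assms
proof (induction rule: cycle_decomp.induct)
  case empty
  show ?case
    by (rule exI[of _ "[]"]) (simp add: cycle_presentation_def id_def)
next
  case (comp I p d)
  then obtain cs where cs: "cycle_presentation cs p" "\<forall>c \<in> set cs. set c \<subseteq> I"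
    by blast
  show ?case
  proof (cases "2 \<le> length d")
    case True
    have "mutually_coprime (cycle_of_list d) (cycle_of_list c)" if "c \<in> set cs" for c
      using that cs(2) comp.hyps(3) moved_points_cycle_subset[of d] moved_points_cycle_subset[of c]
      unfolding mutually_coprime_def by blast
    with True cs comp.hyps(2) have "cycle_presentation (d # cs) (cycle_of_list d \<circ> p)"
      by (simp add: cycle_presentation_def)
    moreover have "\<forall>c \<in> set (d # cs). set c \<subseteq> set d \<union> I"
      using cs(2) by auto
    ultimately show ?thesis
      by blast
  next
    case False
    with cs show ?thesis
      by (auto simp: cycle_of_list_short)
  qed
qed

lemma cycle_presentation_exists:
  assumes "p permutes S" "finite S"
  shows "\<exists>cs. cycle_presentation cs p"
  using cycle_presentation_exists_aux[OF cycle_decomposition[OF assms]] by blast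

end

theory Submission
  imports Defs "HOL-Combinatorics.Orbits"
begin

text \<open>
  Coprime permutations commute, so \<open>h\<^sup>2 t\<^sup>2 = (h t)\<^sup>2\<close>, and all four claims reduce to one fact:
  the square \<open>g = s\<^sup>2\<close> of a permutation has an even number of cycles of each even length \<open>m\<close>.

  To see this, let \<open>s\<close> act on the \<open>g\<close>-orbits of size \<open>m\<close>. This is possible because \<open>s\<close> commutes
  with \<open>g\<close>, and it is an involution because \<open>s\<^sup>2 = g\<close> fixes every \<open>g\<close>-orbit. It has no fixed
  point (\<open>square_root_moves_orbit_of_even_size\<close>): if \<open>s\<close> mapped the orbit of \<open>x\<close> to itself, then
  \<open>s x = g\<^sup>j x = s\<^sup>2\<^sup>j x\<close> for some \<open>j > 0\<close>, so \<open>s\<close>, and hence \<open>g\<close>, would return \<open>x\<close> to itself after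
  the odd number \<open>2 j - 1\<close> of steps, whereas \<open>m\<close> divides every number of steps after which \<open>g\<close>
  returns. So the orbits come in pairs.

  The count of cycles in a presentation agrees with this count of orbits since the point sets of
  the listed cycles are precisely the nontrivial orbits (\<open>orbit_cycle_presentation\<close>,
  \<open>cycle_presentation_fixes_outside\<close>), each listed once (\<open>distinct_cycle_supports\<close>).
\<close>

section \<open>Orbits of the square of a permutation\<close>

lemma even_card_fixpoint_free_involution:
  assumes "\<And>a. a \<in> A \<Longrightarrow> f a \<in> A" "\<And>a. a \<in> A \<Longrightarrow> f (f a) = a" "\<And>a. a \<in> A \<Longrightarrow> f a \<noteq> a"
  shows "even (card A)"
proof (cases "finite A")
  case True
  let ?C = "(\<lambda>a. {a, f a}) ` A"
  have "2 dvd card (\<Union> ?C)"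
  proof (rule dvd_partition)
    show "finite (\<Union> ?C)"
      using True by auto
    show "\<forall>c \<in> ?C. 2 dvd card c"
    proof
      fix c assume "c \<in> ?C"
      then obtain a where "a \<in> A" "c = {a, f a}"
        by blast
      then have "card c = 2"
        using assms(3)[of a] by simp
      then show "2 dvd card c"
        by simp
    qed
    show "\<forall>c1 \<in> ?C. \<forall>c2 \<in> ?C. c1 \<noteq> c2 \<longrightarrow> c1 \<inter> c2 = {}"
      by auto (metis assms(2))+
  qed
  moreover have "\<Union> ?C = A"
    using assms(1) by auto
  ultimately show ?thesis
    by simp
qed simp

text \<open>
  Through \<^const>\<open>least_power\<close>, the size of an orbit divides every number of steps after which
  one of its points returns.
\<close>

lemma card_orbit:
  assumes "permutation p"
  shows "card (orbit p x) = least_power p x"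
proof -
  have "orbit p x = set (support p x)"
    unfolding support_set[OF assms] orbit_altdef_permutation[OF assms] by auto
  then show ?thesis
    using distinct_card[OF cycle_of_permutation[OF assms, of x]] by simp
qed

text \<open>
  On a \<open>g\<close>-orbit that it maps to itself, a square root \<open>s\<close> of \<open>g\<close> would have to act as a power
  \<open>g\<^sup>j\<close> with \<open>2 j \<equiv> 1\<close> modulo the size of the orbit, that is, 2 would be invertible modulo an
  even number.
\<close>

lemma square_root_moves_orbit_of_even_size:
  assumes s: "permutation s" and even: "even (card (orbit (s \<circ> s) x))"
  shows "s ` orbit (s \<circ> s) x \<noteq> orbit (s \<circ> s) x"
proof
  let ?g = "s \<circ> s"
  assume stable: "s ` orbit ?g x = orbit ?g x"
  have g: "permutation ?g"
    using s by (simp add: permutation_compose)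
  have pow_g: "?g ^^ i = s ^^ (2 * i)" for i
    using funpow_mult[where f = s and m = 2 and n = i] by (simp add: numeral_2_eq_2)
  have "s x \<in> orbit ?g x"
    using stable permutation_self_in_orbit[OF g] by blast
  then obtain j where j: "0 < j" "s x = (?g ^^ j) x"
    by (auto simp only: orbit_altdef)
  define r where "r = 2 * j - 1"
  have "(s ^^ 1) x = (s ^^ (2 * j)) x"
    using j(2) unfolding pow_g by simp
  then have "(s ^^ r) x = x"
    unfolding r_def using bij_is_inj[OF permutation_bijective[OF s]] j(1)
    by (intro Cycles.funpow_diff) simp_all
  moreover have "?g ^^ r = s ^^ r \<circ> s ^^ r"
    unfolding pow_g mult_2 funpow_add ..
  ultimately have "(?g ^^ r) x = x"
    by simp
  then have "card (orbit ?g x) dvd r"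
    unfolding card_orbit[OF g] by (rule least_power_minimal)
  with even have "even r"
    by (rule dvd_trans)
  with j(1) show False
    unfolding r_def by simp
qed

text \<open>
  The involution without fixed points is \<open>X \<mapsto> s ` X\<close>; it maps orbits to orbits because \<open>s\<close>
  commutes with \<open>s \<circ> s\<close>. Geometrically, a cycle of \<open>s\<close> of length \<open>2 m\<close> splits in \<open>s \<circ> s\<close> into
  two cycles of length \<open>m\<close>, and for even \<open>m\<close> every cycle of length \<open>m\<close> arises in this way.
\<close>

lemma even_number_of_orbits_of_square:
  assumes s: "permutation s" and "even m"
  shows "even (card {X \<in> range (orbit (s \<circ> s)). card X = m})"
proof (rule even_card_fixpoint_free_involution)
  let ?g = "s \<circ> s"
  have g: "permutation ?g"
    using s by (simp add: permutation_compose)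
  have inj: "inj s"
    using s permutation_bijective bij_is_inj by blast
  have image: "p ` orbit ?g x = orbit ?g (p x)" if "\<And>y. ?g (p y) = p (?g y)" for p x
    using permutation_self_in_orbit[OF g] that by (rule orbit_inverse)
  fix X assume "X \<in> {X \<in> range (orbit ?g). card X = m}"
  then obtain x where x: "X = orbit ?g x" "card X = m"
    by blast
  have "s ` X = orbit ?g (s x)"
    unfolding x(1) by (rule image) simp
  moreover have "card (s ` X) = card X"
    using inj by (intro card_image) (auto intro: inj_on_subset)
  ultimately show "s ` X \<in> {X \<in> range (orbit ?g). card X = m}"
    using x(2) by simp
  have "?g ` X = orbit ?g (?g x)"
    unfolding x(1) by (rule image) simp
  then show "s ` s ` X = X"
    unfolding x(1) permutation_orbit_step[OF g] by (simp add: image_comp)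
  show "s ` X \<noteq> X"
    using square_root_moves_orbit_of_even_size[OF s, of x] x \<open>even m\<close> by simp
qed

section \<open>Cycle presentations and orbits\<close>

lemma orbit_cycle_of_list:
  assumes "cycle c" "x \<in> set c"
  shows "orbit (cycle_of_list c) x = set c"
proof
  show "orbit (cycle_of_list c) x \<subseteq> set c"
    using cycle_permutes assms(2) by (rule permutes_orbit_subset)
  show "set c \<subseteq> orbit (cycle_of_list c) x"
  proof
    fix y assume "y \<in> set c"
    then obtain j where j: "j < length c" "y = c ! j"
      by (auto simp: in_set_conv_nth)
    obtain i where i: "i < length c" "x = c ! i"
      using assms(2) by (auto simp: in_set_conv_nth)
    \<comment> \<open>Going once around the cycle keeps the number of steps from position \<open>i\<close> to \<open>j\<close> a natural number.\<close>
    define d where "d = length c + j - i"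
    have "(cycle_of_list c ^^ d) x = rotate d c ! i"
      using i by (simp flip: cyclic_rotation[OF assms(1)])
    also have "\<dots> = y"
      using i j by (simp add: nth_rotate d_def)
    finally have "(cycle_of_list c ^^ d) x = y" .
    moreover have "0 < d"
      using i(1) by (simp add: d_def)
    ultimately show "y \<in> orbit (cycle_of_list c) x"
      unfolding orbit_altdef by blast
  qed
qed

lemma moved_points_cycle_of_list:
  assumes "cycle c" "2 \<le> length c"
  shows "moved_points (cycle_of_list c) = set c"
proof
  show "moved_points (cycle_of_list c) \<subseteq> set c"
    by (rule moved_points_cycle_subset)
  show "set c \<subseteq> moved_points (cycle_of_list c)"
  proof
    fix x assume "x \<in> set c"
    then have "card (orbit (cycle_of_list c) x) \<ge> 2"
      using assms by (simp add: orbit_cycle_of_list distinct_card)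
    then show "x \<in> moved_points (cycle_of_list c)"
      using orbit_eq_singleton_iff[of "cycle_of_list c" x] by (auto simp: moved_points_def)
  qed
qed

lemma cycle_presentation_Cons:
  assumes "cycle_presentation (c # cs) g"
  obtains g' where "cycle_presentation cs g'" "g = cycle_of_list c \<circ> g'"
    "cycle c" "2 \<le> length c" "\<And>d. d \<in> set cs \<Longrightarrow> set c \<inter> set d = {}"
proof
  let ?g' = "foldr (\<lambda>c p. cycle_of_list c \<circ> p) cs id"
  show "cycle_presentation cs ?g'" "g = cycle_of_list c \<circ> ?g'" "cycle c" "2 \<le> length c"
    using assms by (auto simp: cycle_presentation_def)
  show "set c \<inter> set d = {}" if "d \<in> set cs" for d
    using assms that by (auto simp: cycle_presentation_def mutually_coprime_def
        simp flip: moved_points_cycle_of_list)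
qed

lemma cycle_presentation_fixes_outside:
  assumes "cycle_presentation cs g" "x \<notin> \<Union> (set ` set cs)"
  shows "g x = x"
  using assms
proof (induction cs arbitrary: g)
  case Nil
  then show ?case
    by (simp add: cycle_presentation_def)
next
  case (Cons c cs)
  from Cons.prems(1) obtain g' where "cycle_presentation cs g'" "g = cycle_of_list c \<circ> g'"
    by (rule cycle_presentation_Cons)
  moreover from this(1) have "g' x = x"
    using Cons.prems(2) by (intro Cons.IH) auto
  ultimately show ?case
    using Cons.prems(2) by (simp add: id_outside_supp)
qed

lemma cycle_presentation_eq_cycle:
  assumes "cycle_presentation cs g" "c \<in> set cs" "x \<in> set c"
  shows "g x = cycle_of_list c x"
  using assms
proof (induction cs arbitrary: g)
  case Nil
  then show ?case
    by simp
next
  case (Cons d cs)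
  from Cons.prems(1) obtain g' where g': "cycle_presentation cs g'" "g = cycle_of_list d \<circ> g'"
    and disj: "\<And>e. e \<in> set cs \<Longrightarrow> set d \<inter> set e = {}"
    by (rule cycle_presentation_Cons) blast
  show ?case
  proof (cases "c \<in> set cs")
    case True
    have "cycle_of_list c x \<in> set c"
      using cycle_permutes[of c] Cons.prems(3) by (simp add: permutes_in_image)
    then have "cycle_of_list c x \<notin> set d"
      using disj[OF True] by blast
    then show ?thesis
      using Cons.IH[OF g'(1) True Cons.prems(3)] g'(2) by (simp add: id_outside_supp)
  next
    case False
    then have "c = d"
      using Cons.prems(2) by simp
    then have "x \<notin> \<Union> (set ` set cs)"
      using disj Cons.prems(3) by blast
    then show ?thesis
      using cycle_presentation_fixes_outside[OF g'(1)] g'(2) \<open>c = d\<close> by simp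
  qed
qed

lemma orbit_cycle_presentation:
  assumes "cycle_presentation cs g" "c \<in> set cs" "x \<in> set c"
  shows "orbit g x = set c"
proof -
  have "cycle c"
    using assms(1,2) by (simp add: cycle_presentation_def)
  have "orbit g x = orbit (cycle_of_list c) x"
  proof (rule orbit_cong0)
    show "x \<in> set c"
      by fact
    show eq: "g y = cycle_of_list c y" if "y \<in> set c" for y
      using assms(1,2) that by (rule cycle_presentation_eq_cycle)
    show "g \<in> set c \<rightarrow> set c"
      using eq cycle_permutes[of c] by (simp add: permutes_in_image)
  qed
  then show ?thesis
    using orbit_cycle_of_list[OF \<open>cycle c\<close> assms(3)] by simp
qed

lemma distinct_cycle_supports:
  assumes "cycle_presentation cs g"
  shows "distinct (map set cs)"
  using assms
proof (induction cs arbitrary: g)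
  case Nil
  then show ?case
    by simp
next
  case (Cons c cs)
  from Cons.prems obtain g' where g': "cycle_presentation cs g'" and c: "2 \<le> length c"
    and disj: "\<And>d. d \<in> set cs \<Longrightarrow> set c \<inter> set d = {}"
    by (rule cycle_presentation_Cons) blast
  have "set c \<noteq> {}"
    using c by auto
  then have "set c \<notin> set ` set cs"
    using disj by fastforce
  with Cons.IH[OF g'] show ?case
    by simp
qed

text \<open>
  Fixed points are orbits of size 1 that no cycle of the presentation records; hence the bound
  on \<open>m\<close>.
\<close>

lemma num_cycles_eq_card_orbits:
  assumes cs: "cycle_presentation cs g" and "2 \<le> m"
  shows "num_cycles m cs = card {X \<in> range (orbit g). card X = m}"
proof -
  let ?ds = "filter (\<lambda>c. length c = m) cs"
  have card_set: "card (set c) = length c" if "c \<in> set cs" for c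
    using cs that by (simp add: cycle_presentation_def distinct_card)
  have "set ` set ?ds = {X \<in> range (orbit g). card X = m}"
  proof
    show "set ` set ?ds \<subseteq> {X \<in> range (orbit g). card X = m}"
    proof
      fix X assume "X \<in> set ` set ?ds"
      then obtain c where c: "c \<in> set cs" "length c = m" "X = set c"
        by auto
      have "c \<noteq> []"
        using c(2) \<open>2 \<le> m\<close> by auto
      then obtain x where "x \<in> set c"
        using hd_in_set by blast
      then have "X = orbit g x"
        using orbit_cycle_presentation[OF cs c(1)] c(3) by simp
      then show "X \<in> {X \<in> range (orbit g). card X = m}"
        using card_set[OF c(1)] c(2,3) by auto
    qed
    show "{X \<in> range (orbit g). card X = m} \<subseteq> set ` set ?ds"
    proof
      fix X assume "X \<in> {X \<in> range (orbit g). card X = m}"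
      then obtain x where x: "X = orbit g x" "card X = m"
        by blast
      then have "g x \<noteq> x"
        using orbit_eq_singleton_iff[of g x] \<open>2 \<le> m\<close> by auto
      then obtain c where c: "c \<in> set cs" "x \<in> set c"
        using cycle_presentation_fixes_outside[OF cs] by blast
      then have "X = set c"
        using orbit_cycle_presentation[OF cs] x(1) by simp
      then show "X \<in> set ` set ?ds"
        using c(1) card_set x(2) by auto
    qed
  qed
  moreover have "distinct (map set ?ds)"
    using distinct_cycle_supports[OF cs] by (simp add: distinct_map inj_on_def)
  ultimately show ?thesis
    using distinct_card[of "map set ?ds"] by (simp add: num_cycles_def)
qed

section \<open>Squares and products of coprime squares\<close>

lemma mutually_coprime_commute:
  assumes "inj h" "inj t" "mutually_coprime h t"
  shows "h \<circ> t = t \<circ> h"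
proof
  fix x
  consider "h x = x" "t x = x" | "h x \<noteq> x" "t x = x" | "h x = x" "t x \<noteq> x"
    using assms(3) by (auto simp: mutually_coprime_def moved_points_def)
  then show "(h \<circ> t) x = (t \<circ> h) x"
  proof cases
    case 1
    then show ?thesis
      by simp
  next
    \<comment> \<open>If \<open>h\<close> moves \<open>x\<close>, it also moves \<open>h x\<close>, which is therefore fixed by \<open>t\<close>; symmetrically below.\<close>
    case 2
    then have "h (h x) \<noteq> h x"
      using assms(1) by (simp add: inj_eq)
    then have "t (h x) = h x"
      using assms(3) by (auto simp: mutually_coprime_def moved_points_def)
    with 2 show ?thesis
      by simp
  next
    case 3
    then have "t (t x) \<noteq> t x"
      using assms(2) by (simp add: inj_eq)
    then have "h (t x) = t x"
      using assms(3) by (auto simp: mutually_coprime_def moved_points_def)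
    with 3 show ?thesis
      by simp
  qed
qed

lemma coprime_squares_eq_square:
  assumes "inj h" "inj t" "mutually_coprime h t"
  shows "(h \<circ> h) \<circ> (t \<circ> t) = (h \<circ> t) \<circ> (h \<circ> t)"
  using mutually_coprime_commute[OF assms] by (metis comp_assoc)

lemma not_square_if_odd_num_cycles:
  assumes "1 \<le> k" "cycle_presentation cs g" "odd (num_cycles (2 * k) cs)" "permutation s"
  shows "g \<noteq> s \<circ> s"
proof
  assume "g = s \<circ> s"
  then have "num_cycles (2 * k) cs = card {X \<in> range (orbit (s \<circ> s)). card X = 2 * k}"
    using num_cycles_eq_card_orbits[OF assms(2), of "2 * k"] assms(1) by simp
  moreover have "even (card {X \<in> range (orbit (s \<circ> s)). card X = 2 * k})"
    using assms(4) by (rule even_number_of_orbits_of_square) simp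
  ultimately show False
    using assms(3) by simp
qed

lemma sym_group_square: "h [^]\<^bsub>sym_group n\<^esub> (2::nat) = h \<circ> h"
  by (simp add: numeral_2_eq_2 nat_pow_def sym_group_mult sym_group_one)

lemma alt_group_square: "h [^]\<^bsub>alt_group n\<^esub> (2::nat) = h \<circ> h"
  by (simp add: numeral_2_eq_2 nat_pow_def alt_group_mult alt_group_one)

theorem proposition1:
  fixes n k :: nat and g :: "nat \<Rightarrow> nat" and cs :: "nat list list"
  assumes "g \<in> carrier (alt_group n)"
    and "k \<ge> 1"
    and "cycle_presentation cs g"
    and "odd (num_cycles (2 * k) cs)"
  shows "\<not> (\<exists>h \<in> carrier (alt_group n). \<exists>t \<in> carrier (alt_group n). mutually_coprime h t \<and>
            g = h [^]\<^bsub>alt_group n\<^esub> (2::nat) \<otimes>\<^bsub>alt_group n\<^esub> t [^]\<^bsub>alt_group n\<^esub> (2::nat)) \<and>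
    \<not> (\<exists>h \<in> carrier (alt_group n). g = h [^]\<^bsub>alt_group n\<^esub> (2::nat)) \<and>
    \<not> (\<exists>h \<in> carrier (sym_group n). \<exists>t \<in> carrier (sym_group n). mutually_coprime h t \<and>
            g = h [^]\<^bsub>sym_group n\<^esub> (2::nat) \<otimes>\<^bsub>sym_group n\<^esub> t [^]\<^bsub>sym_group n\<^esub> (2::nat)) \<and>
    \<not> (\<exists>h \<in> carrier (sym_group n). g = h [^]\<^bsub>sym_group n\<^esub> (2::nat))"
proof -
  note no_square = not_square_if_odd_num_cycles[OF assms(2-4)]
  have no_product: "g \<noteq> (h \<circ> h) \<circ> (t \<circ> t)"
    if "permutation h" "permutation t" "mutually_coprime h t" for h t
  proof -
    have "inj h" "inj t"
      using that permutation_bijective bij_is_inj by blast+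
    then show ?thesis
      using no_square[OF permutation_compose[OF that(1,2)]]
        coprime_squares_eq_square that(3) by metis
  qed
  show ?thesis
    unfolding sym_group_square alt_group_square sym_group_mult alt_group_mult
    using no_square no_product sym_group_carrier' alt_group_carrier' by blast
qed

end
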